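(* Let $j,k\ge 2$ be integers, let $v$ be a $(j,k)$ simple game for $n$ players, and let $\hat v$ be its natural embedding as an interval simple game (with discretization $\alpha=(0,\tfrac1j,\tfrac2j,\dots,\tfrac{j-1}j,1)$). Then $\operatorname{SSI}(v)=\Psi(\hat v)$.
   Context: Let $N=\{1,\dots,n\}$. For $x,y\in\mathbb{R}^n$ write $x\le y$ if $x_i\le y_i$ for all $i$. For $S\subseteq N$, $x_S=(x_i)_{i\in S}$, and $(x_S,y_{N\setminus S})$ is the vector with entries $x_i$ for $i\in S$ and $y_i$ for $i\notin S$. For a permutation $\pi$ of $N$ and $i\in N$ let $\pi_{<i}=\{h\in N:\pi(h)<\pi(i)\}$, and define $\pi_{\le i},\pi_{>i},\pi_{\ge i}$ analogously. **$(j,k)$ simple games.** Let $J=\{0,\dots,j-1\}$, $K=\{0,\dots,k-1\}$. A $(j,k)$ simple game is a map $v:J^n\to K$ with $v(0,\dots,0)=0$, $v(j-1,\dots,j-1)=k-1$, and $v(x)\le v(y)$ whenever $x\le y$. Its Shapley-Shubik index is the vector $\operatorname{SSI}(v)\in\mathbb{R}^n$ with $$\operatorname{SSI}_i(v)=\frac1{n!\,j^n(k-1)}\sum_{(\pi,x)\in\mathcal S_n\times J^n}\Big([v(x_{\pi_{<i}},\mathbf 1_{\pi_{\ge i}})-v(x_{\pi_{<i}},\mathbf 0_{\pi_{\ge i}})]-[v(x_{\pi_{\le i}},\mathbf 1_{\pi_{>i}})-v(x_{\pi_{\le i}},\mathbf 0_{\pi_{>i}})]\Big),$$ where in this formula $\mathbf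 0$ is the all-zero vector and $\mathbf 1$ denotes the vector all of whose entries are $j-1$. **Interval simple games.** An interval simple game is a function $w:[0,1]^n\to[0,1]$ with $w(\mathbf 0)=0$, $w(\mathbf 1)=1$ (here $\mathbf 1$ is the all-one vector), and $w(x)\le w(y)$ whenever $x\le y$. For such $w$, $$\Psi_i(w)=\frac1{n!}\sum_{\pi\in\mathcal S_n}\int_{[0,1]^n}\Big([w(x_{\pi_{<i}},\mathbf 1_{\pi_{\ge i}})-w(x_{\pi_{<i}},\mathbf 0_{\pi_{\ge i}})]-[w(x_{\pi_{\le i}},\mathbf 1_{\pi_{>i}})-w(x_{\pi_{\le i}},\mathbf 0_{\pi_{>i}})]\Big)\,dx .$$ **Regular step functions.** For $p\ge1$ and $0=\alpha_0<\alpha_1<\dots<\alpha_p=1$, let $\mathcal A_p=\{0,\tfrac12,1,\dots,p-\tfrac12,p\}^n$ and $\overline{\mathcal A}_p=\{\tfrac12,\tfrac32,\dots,p-\tfrac12\}^n$. For $e\in\mathcal A_p$ let $(\alpha)_e=I_1\times\dots\times I_n$ with $I_h=\{\alpha_{e_h}\}$ if $e_h$ is an integer and $I_h=(\alpha_{e_h-1/2},\alpha_{e_h+1/2})$ otherwise; $[\alpha]_e$ is its closure and $c_e$ its center. A step function with discretization $\alpha=(\alpha_0,\dots,\alpha_p)$ is a function $f:[0,1]^n\to[0,1]$ constant on each $(\alpha)_e$, $e\in\mathcal A_p$. It is regular if $f(\mathbf 0)=0$, $f(\mathbf 1)=1$, and $f(x)=\frac1{|E(x)|}\sum_{e\in E(x)}f(c_e)$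 for all $x\in[0,1]^n\setminus\{\mathbf 0,\mathbf 1\}$, where $E(x)=\{e\in\overline{\mathcal A}_p:x\in[\alpha]_e\}$. A regular step function is determined by its values on the sets $(\alpha)_e$, $e\in\overline{\mathcal A}_p$. **Natural embedding.** $\hat v$ is the regular step function with discretization $\alpha=(0,\tfrac1j,\dots,\tfrac{j-1}j,1)$ (so $p=j$) uniquely determined by $\hat v(x)=v(e)/(k-1)$ for all $x\in(\alpha)_{\bar e}$ and all $\bar e\in\overline{\mathcal A}_j$, where $e=\bar e-\tfrac12\cdot(1,\dots,1)\in J^n$. It is an interval simple game. *)

theory Defs
  imports "HOL-Analysis.Analysis" "HOL-Combinatorics.Combinatorics"
begin

text \<open>
  The players are \<open>{1..n}\<close>, and a vector with entries in \<open>A\<close> is an element of \<open>{1..n} \<rightarrow>\<^sub>E A\<close>, i.e. a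
  function that is \<open>undefined\<close> outside \<open>{1..n}\<close>, so that equality of functions is equality of vectors.
\<close>

definition const_vec :: "nat \<Rightarrow> 'a \<Rightarrow> nat \<Rightarrow> 'a" where
  "const_vec n c = (\<lambda>h\<in>{1..n}. c)"

definition vec_le :: "nat \<Rightarrow> (nat \<Rightarrow> 'a::order) \<Rightarrow> (nat \<Rightarrow> 'a) \<Rightarrow> bool" where
  "vec_le n x y \<longleftrightarrow> (\<forall>h\<in>{1..n}. x h \<le> y h)"

definition glue :: "nat \<Rightarrow> nat set \<Rightarrow> (nat \<Rightarrow> 'a) \<Rightarrow> (nat \<Rightarrow> 'a) \<Rightarrow> nat \<Rightarrow> 'a" where
  "glue n S x y = (\<lambda>h\<in>{1..n}. if h \<in> S then x h else y h)"

definition before :: "nat \<Rightarrow> (nat \<Rightarrow> nat) \<Rightarrow> nat \<Rightarrow> nat set" where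
  "before n \<pi> i = {h \<in> {1..n}. \<pi> h < \<pi> i}"

definition upto_incl :: "nat \<Rightarrow> (nat \<Rightarrow> nat) \<Rightarrow> nat \<Rightarrow> nat set" where
  "upto_incl n \<pi> i = {h \<in> {1..n}. \<pi> h \<le> \<pi> i}"

text \<open>
  The summand (integrand) common to both indices, where \<open>lo\<close> and \<open>hi\<close> are the least and the
  greatest possible entry of a vector.
\<close>

definition influence_drop ::
  "nat \<Rightarrow> 'a \<Rightarrow> 'a \<Rightarrow> ((nat \<Rightarrow> 'a) \<Rightarrow> real) \<Rightarrow> nat \<Rightarrow> (nat \<Rightarrow> nat) \<Rightarrow> (nat \<Rightarrow> 'a) \<Rightarrow> real" where
  "influence_drop n lo hi u i \<pi> x =
     (u (glue n (before n \<pi> i) x (const_vec n hi)) -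
      u (glue n (before n \<pi> i) x (const_vec n lo))) -
     (u (glue n (upto_incl n \<pi> i) x (const_vec n hi)) -
      u (glue n (upto_incl n \<pi> i) x (const_vec n lo)))"

definition jk_simple_game :: "nat \<Rightarrow> nat \<Rightarrow> nat \<Rightarrow> ((nat \<Rightarrow> nat) \<Rightarrow> nat) \<Rightarrow> bool" where
  "jk_simple_game n j k v \<longleftrightarrow>
     v \<in> ({1..n} \<rightarrow>\<^sub>E {0..<j}) \<rightarrow> {0..<k} \<and>
     v (const_vec n 0) = 0 \<and>
     v (const_vec n (j - 1)) = k - 1 \<and>
     (\<forall>x\<in>{1..n} \<rightarrow>\<^sub>E {0..<j}. \<forall>y\<in>{1..n} \<rightarrow>\<^sub>E {0..<j}. vec_le n x y \<longrightarrow> v x \<le> v y)"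

definition SSI :: "nat \<Rightarrow> nat \<Rightarrow> nat \<Rightarrow> ((nat \<Rightarrow> nat) \<Rightarrow> nat) \<Rightarrow> nat \<Rightarrow> real" where
  "SSI n j k v = (\<lambda>i\<in>{1..n}.
     1 / (fact n * real j ^ n * (real k - 1)) *
     (\<Sum>(\<pi>, x)\<in>{\<pi>. \<pi> permutes {1..n}} \<times> ({1..n} \<rightarrow>\<^sub>E {0..<j}).
        influence_drop n 0 (j - 1) (\<lambda>y. real (v y)) i \<pi> x))"

definition cube :: "nat \<Rightarrow> (nat \<Rightarrow> real) set" where
  "cube n = {1..n} \<rightarrow>\<^sub>E {0..1}"

definition interval_simple_game :: "nat \<Rightarrow> ((nat \<Rightarrow> real) \<Rightarrow> real) \<Rightarrow> bool" where
  "interval_simple_game n w \<longleftrightarrow>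
     w \<in> cube n \<rightarrow> {0..1} \<and>
     w (const_vec n 0) = 0 \<and>
     w (const_vec n 1) = 1 \<and>
     (\<forall>x\<in>cube n. \<forall>y\<in>cube n. vec_le n x y \<longrightarrow> w x \<le> w y)"

text \<open>
  The index \<open>\<Psi>\<close> of an interval simple game. The product measure is completed because a coordinatewise
  monotone function need not be Borel measurable, although it is Lebesgue measurable.
\<close>

definition Psi :: "nat \<Rightarrow> ((nat \<Rightarrow> real) \<Rightarrow> real) \<Rightarrow> nat \<Rightarrow> real" where
  "Psi n w = (\<lambda>i\<in>{1..n}.
     1 / fact n *
     (\<Sum>\<pi>\<in>{\<pi>. \<pi> permutes {1..n}}.
        LINT x:cube n|completion (PiM {1..n} (\<lambda>_. lborel)). influence_drop n 0 1 w i \<pi> x))"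

definition discretization :: "nat \<Rightarrow> (nat \<Rightarrow> real) \<Rightarrow> bool" where
  "discretization p \<alpha> \<longleftrightarrow> p \<ge> 1 \<and> \<alpha> 0 = 0 \<and> \<alpha> p = 1 \<and> strict_mono_on {0..p} \<alpha>"

text \<open>
  Cells are indexed by vectors of half-integers: \<open>half_grid\<close> is \<open>{0, 1/2, ..., p - 1/2, p}\<^sup>n\<close> and
  \<open>open_grid\<close>, which indexes the full-dimensional cells, is \<open>{1/2, 3/2, ..., p - 1/2}\<^sup>n\<close>.
\<close>

definition half_grid :: "nat \<Rightarrow> nat \<Rightarrow> (nat \<Rightarrow> real) set" where
  "half_grid n p = {1..n} \<rightarrow>\<^sub>E {real m / 2 |m. m \<le> 2 * p}"

definition open_grid :: "nat \<Rightarrow> nat \<Rightarrow> (nat \<Rightarrow> real) set" where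
  "open_grid n p = {1..n} \<rightarrow>\<^sub>E {real m + 1 / 2 |m. m < p}"

text \<open>For \<open>t\<close> a half-integer, the arguments of \<open>\<alpha>\<close> below are exactly \<open>t\<close>, \<open>t - 1/2\<close> and \<open>t + 1/2\<close>.\<close>

definition side :: "(nat \<Rightarrow> real) \<Rightarrow> real \<Rightarrow> real set" where
  "side \<alpha> t = (if t \<in> \<int> then {\<alpha> (nat \<lfloor>t\<rfloor>)}
               else {\<alpha> (nat \<lfloor>t - 1 / 2\<rfloor>) <..< \<alpha> (nat \<lfloor>t + 1 / 2\<rfloor>)})"

definition side_center :: "(nat \<Rightarrow> real) \<Rightarrow> real \<Rightarrow> real" where
  "side_center \<alpha> t = (if t \<in> \<int> then \<alpha> (nat \<lfloor>t\<rfloor>)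
                      else (\<alpha> (nat \<lfloor>t - 1 / 2\<rfloor>) + \<alpha> (nat \<lfloor>t + 1 / 2\<rfloor>)) / 2)"

definition cell :: "nat \<Rightarrow> (nat \<Rightarrow> real) \<Rightarrow> (nat \<Rightarrow> real) \<Rightarrow> (nat \<Rightarrow> real) set" where
  "cell n \<alpha> e = (\<Pi>\<^sub>E h\<in>{1..n}. side \<alpha> (e h))"

definition closed_cell :: "nat \<Rightarrow> (nat \<Rightarrow> real) \<Rightarrow> (nat \<Rightarrow> real) \<Rightarrow> (nat \<Rightarrow> real) set" where
  "closed_cell n \<alpha> e = (\<Pi>\<^sub>E h\<in>{1..n}. closure (side \<alpha> (e h)))"

definition center :: "nat \<Rightarrow> (nat \<Rightarrow> real) \<Rightarrow> (nat \<Rightarrow> real) \<Rightarrow> nat \<Rightarrow> real" where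
  "center n \<alpha> e = (\<lambda>h\<in>{1..n}. side_center \<alpha> (e h))"

definition adjacent_cells :: "nat \<Rightarrow> nat \<Rightarrow> (nat \<Rightarrow> real) \<Rightarrow> (nat \<Rightarrow> real) \<Rightarrow> (nat \<Rightarrow> real) set" where
  "adjacent_cells n p \<alpha> x = {e \<in> open_grid n p. x \<in> closed_cell n \<alpha> e}"

text \<open>Step functions are taken extensional, so that a regular one is determined on the whole type.\<close>

definition step_function ::
  "nat \<Rightarrow> nat \<Rightarrow> (nat \<Rightarrow> real) \<Rightarrow> ((nat \<Rightarrow> real) \<Rightarrow> real) \<Rightarrow> bool" where
  "step_function n p \<alpha> f \<longleftrightarrow>
     discretization p \<alpha> \<and>
     f \<in> cube n \<rightarrow>\<^sub>E {0..1} \<and>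
     (\<forall>e\<in>half_grid n p. f constant_on cell n \<alpha> e)"

definition regular_step_function ::
  "nat \<Rightarrow> nat \<Rightarrow> (nat \<Rightarrow> real) \<Rightarrow> ((nat \<Rightarrow> real) \<Rightarrow> real) \<Rightarrow> bool" where
  "regular_step_function n p \<alpha> f \<longleftrightarrow>
     step_function n p \<alpha> f \<and>
     f (const_vec n 0) = 0 \<and>
     f (const_vec n 1) = 1 \<and>
     (\<forall>x\<in>cube n - {const_vec n 0, const_vec n 1}.
        f x = 1 / real (card (adjacent_cells n p \<alpha> x)) *
              (\<Sum>e\<in>adjacent_cells n p \<alpha> x. f (center n \<alpha> e)))"

definition natural_embedding ::
  "nat \<Rightarrow> nat \<Rightarrow> nat \<Rightarrow> ((nat \<Rightarrow> nat) \<Rightarrow> nat) \<Rightarrow> (nat \<Rightarrow> real) \<Rightarrow> real" where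
  "natural_embedding n j k v =
     (let \<alpha> = (\<lambda>m. real m / real j) in
      THE f. regular_step_function n j \<alpha> f \<and>
        (\<forall>e\<in>open_grid n j. \<forall>x\<in>cell n \<alpha> e.
           f x = real (v (\<lambda>h\<in>{1..n}. nat \<lfloor>e h - 1 / 2\<rfloor>)) / (real k - 1)))"

end

theory Submission
  imports Defs
begin

text \<open>
  Up to a null set, the cube splits into the \<open>j\<^sup>n\<close> open boxes with corners in \<open>(1/j) \<int>\<^sup>n\<close>, indexed by
  \<open>J\<^sup>n\<close>. If \<open>x\<close> lies in the box of \<open>y\<close> and some of its coordinates are replaced by \<open>0\<close> (or all of
  these by \<open>1\<close>), then the resulting point still lies in exactly one closed box, namely that of \<open>y\<close>
  with the same coordinates replaced by \<open>0\<close> (or \<open>j - 1\<close>). Hence no averaging takes place, the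
  integrand of \<open>\<Psi>\<close> is constant on each box, equal to the summand of the index of \<open>v\<close> divided by
  \<open>k - 1\<close>, and each box has volume \<open>j\<^sup>-\<^sup>n\<close>.
\<close>

section \<open>Cells of a discretization\<close>

text \<open>Doubling would equate an odd integer with an even one. The fact selects the non-integer
  branch of \<open>side\<close> and \<open>side_center\<close>.\<close>

lemma half_not_Ints: "real m + 1 / 2 \<notin> \<int>"
proof
  assume "real m + 1 / 2 \<in> \<int>"
  then obtain z :: int where "real m + 1 / 2 = of_int z"
    by (elim Ints_cases)
  then have "real_of_int (2 * int m + 1) = real_of_int (2 * z)"
    by simp
  then have "2 * int m + 1 = 2 * z"
    by (simp only: of_int_eq_iff)
  then show False
    by presburger
qed

lemma side_of_nat [simp]: "side \<alpha> (real m) = {\<alpha> m}"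
  by (simp add: side_def)

lemma side_half [simp]: "side \<alpha> (real m + 1 / 2) = {\<alpha> m <..< \<alpha> (Suc m)}"
proof -
  have "\<lfloor>real m + 1 / 2 - 1 / 2\<rfloor> = int m" "\<lfloor>real m + 1 / 2 + 1 / 2\<rfloor> = int (Suc m)"
    by linarith+
  then show ?thesis
    using half_not_Ints[of m] by (simp only: side_def nat_int if_False)
qed

lemma side_center_half [simp]: "side_center \<alpha> (real m + 1 / 2) = (\<alpha> m + \<alpha> (Suc m)) / 2"
proof -
  have "\<lfloor>real m + 1 / 2 - 1 / 2\<rfloor> = int m" "\<lfloor>real m + 1 / 2 + 1 / 2\<rfloor> = int (Suc m)"
    by linarith+
  then show ?thesis
    using half_not_Ints[of m] by (simp only: side_center_def nat_int if_False)
qed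

lemma discretization_uniform:
  assumes "j \<ge> 1"
  shows "discretization j (\<lambda>m. real m / real j)"
proof -
  have "strict_mono_on {0..j} (\<lambda>m. real m / real j)"
    using assms by (intro strict_mono_onI divide_strict_right_mono) simp_all
  then show ?thesis using assms by (simp add: discretization_def)
qed

lemma discretization_strict:
  assumes "discretization p \<alpha>" "a < b" "b \<le> p"
  shows "\<alpha> a < \<alpha> b"
  using assms unfolding discretization_def by (auto intro: strict_mono_onD)

lemma discretization_mono:
  assumes "discretization p \<alpha>" "a \<le> b" "b \<le> p"
  shows "\<alpha> a \<le> \<alpha> b"
  using discretization_strict[OF assms(1), of a b] assms by (cases "a = b") auto

lemma discretization_bounds:
  assumes "discretization p \<alpha>" "m \<le> p"
  shows "0 \<le> \<alpha> m" "\<alpha> m \<le> 1"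
  using discretization_mono[OF assms(1), of 0 m] discretization_mono[OF assms(1), of m p] assms
  by (auto simp: discretization_def)

text \<open>Strict monotonicity of \<open>\<alpha>\<close> matters here: the closure of an empty
  open interval would be empty rather than a single point.\<close>

lemma closure_side_half:
  assumes "discretization p \<alpha>" "m < p"
  shows "closure (side \<alpha> (real m + 1 / 2)) = {\<alpha> m .. \<alpha> (Suc m)}"
  using discretization_strict[OF assms(1), of m "Suc m"] assms(2)
  by simp

text \<open>Distinct intervals share at most an endpoint, and \<open>t\<close> is interior to the
  one with index \<open>m\<close>. With both intervals closed the claim would fail at the interior
  grid points.\<close>

lemma interval_index_unique:
  assumes \<alpha>: "discretization p \<alpha>" and "m < p" "m' < p"
    and t: "t \<in> {\<alpha> m <..< \<alpha> (Suc m)}" and t': "t \<in> {\<alpha> m' .. \<alpha> (Suc m')}"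
  shows "m' = m"
proof (rule linorder_cases[of m m'])
  assume "m < m'"
  then show ?thesis
    using discretization_mono[OF \<alpha>, of "Suc m" m'] \<open>m' < p\<close> t t' by simp
next
  assume "m' < m"
  then show ?thesis
    using discretization_mono[OF \<alpha>, of "Suc m'" m] \<open>m < p\<close> t t' by simp
qed simp

lemma open_gridE:
  assumes "e \<in> open_grid n p" "h \<in> {1..n}"
  obtains m where "m < p" "e h = real m + 1 / 2"
  using assms unfolding open_grid_def PiE_def by blast

lemma half_gridE:
  assumes "e \<in> half_grid n p" "h \<in> {1..n}"
  obtains m where "m \<le> p" "e h = real m" | m where "m < p" "e h = real m + 1 / 2"
proof -
  obtain m where m: "m \<le> 2 * p" "e h = real m / 2"
    using assms unfolding half_grid_def PiE_def by blast
  show thesis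
  proof (cases "even m")
    case True
    then obtain l where "m = 2 * l" by blast
    then show ?thesis using m that(1)[of l] by simp
  next
    case False
    then obtain l where "m = 2 * l + 1" by (blast elim: oddE)
    then show ?thesis using m that(2)[of l] by (simp add: field_simps)
  qed
qed

lemma finite_open_grid: "finite (open_grid n p)"
  unfolding open_grid_def by (intro finite_PiE) auto

lemma finite_adjacent_cells: "finite (adjacent_cells n p \<alpha> x)"
  unfolding adjacent_cells_def using finite_open_grid by simp

lemma cell_subset_cube:
  assumes \<alpha>: "discretization p \<alpha>" and "e \<in> half_grid n p"
  shows "cell n \<alpha> e \<subseteq> cube n"
  unfolding cell_def cube_def
proof (rule PiE_mono)
  fix h assume "h \<in> {1..n}"
  with assms(2) show "side \<alpha> (e h) \<subseteq> {0..1}"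
  proof (cases rule: half_gridE)
    case (1 m)
    then show ?thesis using discretization_bounds[OF \<alpha>] by simp
  next
    case (2 m)
    then show ?thesis
      using discretization_bounds[OF \<alpha>, of m] discretization_bounds[OF \<alpha>, of "Suc m"] by auto
  qed
qed

lemma open_grid_subset_half_grid: "open_grid n p \<subseteq> half_grid n p"
  unfolding open_grid_def half_grid_def
proof (rule PiE_mono)
  have "\<exists>m. real l + 1 / 2 = real m / 2 \<and> m \<le> 2 * p" if "l < p" for l
    using that by (intro exI[of _ "2 * l + 1"]) (simp add: field_simps)
  then show "{real m + 1 / 2 |m. m < p} \<subseteq> {real m / 2 |m. m \<le> 2 * p}"
    by auto
qed

section \<open>Closed full-dimensional cells containing a given point\<close>

text \<open>Closed cells are products, so uniqueness can be tested in each coordinate. The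
  hypothesis \<open>unique\<close> is met by coordinates interior to an interval, and also by the
  coordinates 0 and 1, which lie only in the first and only in the last closed interval.\<close>

lemma adjacent_cells_eq_singleton:
  assumes \<alpha>: "discretization p \<alpha>" and e: "e \<in> open_grid n p" "x \<in> closed_cell n \<alpha> e"
    and unique: "\<And>h m. h \<in> {1..n} \<Longrightarrow> m < p \<Longrightarrow> x h \<in> {\<alpha> m .. \<alpha> (Suc m)} \<Longrightarrow> e h = real m + 1 / 2"
  shows "adjacent_cells n p \<alpha> x = {e}"
proof -
  have "d = e" if d: "d \<in> open_grid n p" "x \<in> closed_cell n \<alpha> d" for d
  proof (rule PiE_ext)
    show "d \<in> Pi\<^sub>E {1..n} (\<lambda>_. {real m + 1 / 2 |m. m < p})"
      "e \<in> Pi\<^sub>E {1..n} (\<lambda>_. {real m + 1 / 2 |m. m < p})"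
      using d e unfolding open_grid_def by auto
    fix h assume h: "h \<in> {1..n}"
    then obtain m where m: "m < p" "d h = real m + 1 / 2"
      using d open_gridE by blast
    then have "x h \<in> {\<alpha> m .. \<alpha> (Suc m)}"
      using d h closure_side_half[OF \<alpha>, of m] unfolding closed_cell_def by (metis PiE_mem)
    then show "d h = e h"
      using unique[OF h] m by simp
  qed
  then show ?thesis
    using e unfolding adjacent_cells_def by blast
qed

lemma adjacent_cells_open_cell:
  assumes \<alpha>: "discretization p \<alpha>" and e: "e \<in> open_grid n p" and x: "x \<in> cell n \<alpha> e"
  shows "adjacent_cells n p \<alpha> x = {e}"
proof (rule adjacent_cells_eq_singleton[OF \<alpha> e])
  show "x \<in> closed_cell n \<alpha> e"
    using x PiE_mono[of "{1..n}" "\<lambda>h. side \<alpha> (e h)" "\<lambda>h. closure (side \<alpha> (e h))"] closure_subset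
    unfolding cell_def closed_cell_def by blast
  fix h m assume h: "h \<in> {1..n}" and m: "m < p" "x h \<in> {\<alpha> m .. \<alpha> (Suc m)}"
  obtain l where l: "l < p" "e h = real l + 1 / 2"
    using e h by (rule open_gridE)
  have "x h \<in> {\<alpha> l <..< \<alpha> (Suc l)}"
    using x h l side_half[of \<alpha> l] unfolding cell_def by (metis PiE_mem)
  then show "e h = real m + 1 / 2"
    using interval_index_unique[OF \<alpha> l(1) m(1) _ m(2)] l by simp
qed

text \<open>In a coordinate where the side of \<open>e\<close> is a point, \<open>x\<close> and
  \<open>y\<close> agree. Where it is an open interval, the only closed interval meeting it is its
  own closure, which also contains the coordinate of \<open>y\<close>. Exchanging \<open>x\<close>
  and \<open>y\<close> gives equality.\<close>

lemma adjacent_cells_mono_cell: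
  assumes \<alpha>: "discretization p \<alpha>" and e: "e \<in> half_grid n p"
    and x: "x \<in> cell n \<alpha> e" and y: "y \<in> cell n \<alpha> e"
  shows "adjacent_cells n p \<alpha> x \<subseteq> adjacent_cells n p \<alpha> y"
proof
  fix d assume d: "d \<in> adjacent_cells n p \<alpha> x"
  have "y h \<in> closure (side \<alpha> (d h))" if h: "h \<in> {1..n}" for h
  proof -
    have sides: "x h \<in> side \<alpha> (e h)" "y h \<in> side \<alpha> (e h)" and xd: "x h \<in> closure (side \<alpha> (d h))"
      using x y d h unfolding cell_def adjacent_cells_def closed_cell_def by (auto simp: PiE_iff)
    obtain l where l: "l < p" "d h = real l + 1 / 2"
      using d h unfolding adjacent_cells_def by (blast elim: open_gridE)
    from e h show ?thesis
    proof (cases rule: half_gridE)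
      case (1 m)
      then show ?thesis using sides xd by simp
    next
      case (2 m)
      have "l = m"
        using interval_index_unique[OF \<alpha> 2(1) l(1)] sides(1) xd
        by (metis 2(2) l closure_side_half[OF \<alpha>] side_half)
      then have "d h = e h" using 2 l by simp
      then show ?thesis using subsetD[OF closure_subset sides(2)] by (simp only:)
    qed
  qed
  then show "d \<in> adjacent_cells n p \<alpha> y"
    using d y unfolding adjacent_cells_def closed_cell_def cell_def by (auto simp: PiE_iff)
qed

lemma center_in_cell:
  assumes \<alpha>: "discretization p \<alpha>" and e: "e \<in> open_grid n p"
  shows "center n \<alpha> e \<in> cell n \<alpha> e"
proof -
  have "side_center \<alpha> (e h) \<in> side \<alpha> (e h)" if h: "h \<in> {1..n}" for h
  proof -
    obtain m where m: "m < p" "e h = real m + 1 / 2"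
      using e h by (rule open_gridE)
    then show ?thesis
      using discretization_strict[OF \<alpha>, of m "Suc m"]
      by (simp only: side_half side_center_half) (simp add: field_simps)
  qed
  then show ?thesis unfolding center_def cell_def by auto
qed

text \<open>The first coordinate lies strictly between 0 and 1. With no coordinates, the only vector
  would equal both corners.\<close>

lemma const_vec_not_in_open_cell:
  assumes \<alpha>: "discretization p \<alpha>" and e: "e \<in> open_grid n p" and n: "n \<ge> 1" and x: "x \<in> cell n \<alpha> e"
  shows "x \<noteq> const_vec n 0" "x \<noteq> const_vec n 1"
proof -
  obtain m where m: "m < p" "e 1 = real m + 1 / 2"
    using e n by (auto elim: open_gridE)
  have "x 1 \<in> {\<alpha> m <..< \<alpha> (Suc m)}"
    using x n m side_half[of \<alpha> m] unfolding cell_def by (metis PiE_mem atLeastAtMost_iff le_refl)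
  then have "0 < x 1" "x 1 < 1"
    using discretization_bounds[OF \<alpha>, of m] discretization_bounds[OF \<alpha>, of "Suc m"] m by auto
  then show "x \<noteq> const_vec n 0" "x \<noteq> const_vec n 1"
    using n by (auto simp: const_vec_def)
qed

section \<open>Regular step functions with prescribed values\<close>

text \<open>The explicit solution of the regularity equations when \<open>g\<close> prescribes the
  values on the full-dimensional cells. The two corners are exempt from averaging, and restriction
  to the cube matches the extensionality of step functions.\<close>

definition regular_extension ::
  "nat \<Rightarrow> nat \<Rightarrow> (nat \<Rightarrow> real) \<Rightarrow> ((nat \<Rightarrow> real) \<Rightarrow> real) \<Rightarrow> (nat \<Rightarrow> real) \<Rightarrow> real" where
  "regular_extension n p \<alpha> g = (\<lambda>x\<in>cube n.
     if x = const_vec n 0 then 0 else if x = const_vec n 1 then 1 else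
     1 / real (card (adjacent_cells n p \<alpha> x)) * (\<Sum>e\<in>adjacent_cells n p \<alpha> x. g e))"

lemma const_vec_in_cube: "c \<in> {0..1} \<Longrightarrow> const_vec n c \<in> cube n"
  by (auto simp: const_vec_def cube_def)

lemma regular_extension_singleton:
  assumes "x \<in> cube n" "x \<noteq> const_vec n 0" "x \<noteq> const_vec n 1" "adjacent_cells n p \<alpha> x = {e}"
  shows "regular_extension n p \<alpha> g x = g e"
  using assms by (simp add: regular_extension_def)

lemma regular_extension_open_cell:
  assumes "discretization p \<alpha>" "e \<in> open_grid n p" "n \<ge> 1" "x \<in> cell n \<alpha> e"
  shows "regular_extension n p \<alpha> g x = g e"
proof (rule regular_extension_singleton)
  show "x \<in> cube n"
    using cell_subset_cube[OF assms(1)] open_grid_subset_half_grid assms by blast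
qed (use assms const_vec_not_in_open_cell adjacent_cells_open_cell in blast)+

text \<open>Existence of a regular step function with prescribed values: averages of numbers in
  [0,1] stay there, the set of adjacent cells is constant on every cell, and a center is adjacent to
  its own cell only, so that averaging \<open>g\<close> is the same as averaging the values at the
  centers.\<close>

lemma regular_step_function_regular_extension:
  assumes \<alpha>: "discretization p \<alpha>" and n: "n \<ge> 1" and g: "g \<in> open_grid n p \<rightarrow> {0..1}"
  shows "regular_step_function n p \<alpha> (regular_extension n p \<alpha> g)"
proof -
  let ?f = "regular_extension n p \<alpha> g"
  have grid: "e \<in> open_grid n p" if "e \<in> adjacent_cells n p \<alpha> x" for e x
    using that by (simp add: adjacent_cells_def)
  \<comment> \<open>An empty \<open>E\<close> is covered as well: the sum is then 0, and so is the
    product.\<close>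
  have "1 / real (card E) * sum g E \<in> {0..1}" if "E = adjacent_cells n p \<alpha> x" for E x
  proof -
    have "0 \<le> sum g E" "sum g E \<le> real (card E)"
      using sum_bounded_above[of E g 1] g grid that
      by (force intro!: sum_nonneg simp: Pi_iff)+
    then show ?thesis by (auto simp: divide_le_eq_1)
  qed
  then have range: "?f \<in> cube n \<rightarrow>\<^sub>E {0..1}"
    by (auto simp: regular_extension_def)
  have const: "?f constant_on cell n \<alpha> e" if e: "e \<in> half_grid n p" for e
  proof -
    have "?f x = ?f y" if xy: "x \<in> cell n \<alpha> e" "y \<in> cell n \<alpha> e" for x y
    proof -
      \<comment> \<open>A cell containing one of the two corners is a single point, since its sides
        contain 0 or 1 and hence are not open intervals. The exceptional values at the corners
        therefore do not spoil constancy on cells.\<close>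
      have "x = y" if c: "x = const_vec n c" "c = 0 \<or> c = 1" and x: "x \<in> cell n \<alpha> e" and y: "y \<in> cell n \<alpha> e" for x y c
      proof (rule PiE_ext[OF x[unfolded cell_def] y[unfolded cell_def]])
        fix h assume h: "h \<in> {1..n}"
        have sides: "x h \<in> side \<alpha> (e h)" "y h \<in> side \<alpha> (e h)"
          using x y h unfolding cell_def by (auto simp: PiE_iff)
        from e h show "x h = y h"
        proof (cases rule: half_gridE)
          case (1 m)
          then show ?thesis using sides by simp
        next
          case (2 m)
          then have "0 < x h" "x h < 1"
            using sides discretization_bounds[OF \<alpha>, of m] discretization_bounds[OF \<alpha>, of "Suc m"]
            by auto
          then show ?thesis using c h by (auto simp: const_vec_def)
        qed
      qed
      from this[of x 0 y] this[of y 0 x] this[of x 1 y] this[of y 1 x]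
      have "x = const_vec n 0 \<longleftrightarrow> y = const_vec n 0" "x = const_vec n 1 \<longleftrightarrow> y = const_vec n 1"
        using xy by metis+
      moreover have "adjacent_cells n p \<alpha> x = adjacent_cells n p \<alpha> y"
        using adjacent_cells_mono_cell[OF \<alpha> e] xy by blast
      moreover have "x \<in> cube n" "y \<in> cube n"
        using xy cell_subset_cube[OF \<alpha> e] by auto
      ultimately show ?thesis by (simp add: regular_extension_def)
    qed
    then show ?thesis unfolding constant_on_def by blast
  qed
  have centers: "?f (center n \<alpha> e) = g e" if "e \<in> open_grid n p" for e
    using regular_extension_open_cell[OF \<alpha> that n center_in_cell[OF \<alpha> that]] .
  \<comment> \<open>The definition tests for the zero vector first, so the value 1 at the other
    corner requires the corners to differ; they do so in coordinate 1.\<close>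
  have "const_vec n (0::real) \<noteq> const_vec n 1"
    using n by (auto simp: const_vec_def fun_eq_iff intro!: exI[of _ 1])
  then have ends: "?f (const_vec n 0) = 0" "?f (const_vec n 1) = 1"
    by (auto simp: regular_extension_def const_vec_in_cube)
  have "?f x = 1 / real (card (adjacent_cells n p \<alpha> x)) * (\<Sum>e\<in>adjacent_cells n p \<alpha> x. ?f (center n \<alpha> e))"
    if "x \<in> cube n - {const_vec n 0, const_vec n 1}" for x
  proof -
    have "(\<Sum>e\<in>adjacent_cells n p \<alpha> x. ?f (center n \<alpha> e)) = (\<Sum>e\<in>adjacent_cells n p \<alpha> x. g e)"
      using centers grid by (intro sum.cong) auto
    then show ?thesis using that by (simp add: regular_extension_def)
  qed
  then show ?thesis
    unfolding regular_step_function_def step_function_def using \<alpha> range const ends by blast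
qed

text \<open>Uniqueness: the regularity equation expresses all values in the cube, except those at
  the two corners, through the values at the centers; the corners and the exterior of the cube are
  fixed by definition.\<close>

lemma regular_step_function_eq_regular_extension:
  assumes f: "regular_step_function n p \<alpha> f"
    and g: "\<And>e. e \<in> open_grid n p \<Longrightarrow> f (center n \<alpha> e) = g e"
  shows "f = regular_extension n p \<alpha> g"
proof
  fix x
  have sums: "(\<Sum>e\<in>adjacent_cells n p \<alpha> x. f (center n \<alpha> e)) = (\<Sum>e\<in>adjacent_cells n p \<alpha> x. g e)"
    by (intro sum.cong) (auto simp: adjacent_cells_def g)
  have "f \<in> cube n \<rightarrow>\<^sub>E {0..1}"
    using f by (simp add: regular_step_function_def step_function_def)
  then have "x \<notin> cube n \<Longrightarrow> f x = undefined"
    by (rule PiE_arb)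
  moreover have "f (const_vec n 0) = 0" "f (const_vec n 1) = 1"
    using f by (simp_all add: regular_step_function_def)
  moreover have "f x = 1 / real (card (adjacent_cells n p \<alpha> x)) * (\<Sum>e\<in>adjacent_cells n p \<alpha> x. g e)"
    if "x \<in> cube n" "x \<noteq> const_vec n 0" "x \<noteq> const_vec n 1"
    using f that unfolding regular_step_function_def sums[symmetric] by blast
  ultimately show "f x = regular_extension n p \<alpha> g x"
    unfolding regular_extension_def by auto
qed

section \<open>The natural embedding in explicit form\<close>

text \<open>Existence and uniqueness of regular step functions resolve the definite description. The
  prescribed values lie in [0,1] because \<open>v\<close> is at most \<open>k - 1\<close> on vectors
  with entries below \<open>j\<close>.\<close>

lemma natural_embedding_eq_regular_extension:
  assumes j: "j \<ge> 1" and n: "n \<ge> 1" and k: "k \<ge> 2"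
    and v: "v \<in> ({1..n} \<rightarrow>\<^sub>E {0..<j}) \<rightarrow> {0..<k}"
  shows "natural_embedding n j k v = regular_extension n j (\<lambda>m. real m / real j)
    (\<lambda>e. real (v (\<lambda>h\<in>{1..n}. nat \<lfloor>e h - 1 / 2\<rfloor>)) / (real k - 1))"
    (is "_ = regular_extension n j ?\<alpha> ?g")
proof -
  have \<alpha>: "discretization j ?\<alpha>"
    using j by (intro discretization_uniform) simp
  have "?g e \<in> {0..1}" if e: "e \<in> open_grid n j" for e
  proof -
    have "nat \<lfloor>e h - 1 / 2\<rfloor> < j" if "h \<in> {1..n}" for h
      using e that by (auto elim!: open_gridE)
    then have "(\<lambda>h\<in>{1..n}. nat \<lfloor>e h - 1 / 2\<rfloor>) \<in> {1..n} \<rightarrow>\<^sub>E {0..<j}"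
      by auto
    then have "v (\<lambda>h\<in>{1..n}. nat \<lfloor>e h - 1 / 2\<rfloor>) < k"
      using funcset_mem[OF v] by (simp only: atLeastLessThan_iff)
    then show ?thesis using k by (auto simp: divide_le_eq_1)
  qed
  then have reg: "regular_step_function n j ?\<alpha> (regular_extension n j ?\<alpha> ?g)"
    by (intro regular_step_function_regular_extension[OF \<alpha> n] funcsetI)
  show ?thesis
    unfolding natural_embedding_def Let_def
  proof (rule the_equality)
    show "regular_step_function n j ?\<alpha> (regular_extension n j ?\<alpha> ?g) \<and>
      (\<forall>e\<in>open_grid n j. \<forall>x\<in>cell n ?\<alpha> e. regular_extension n j ?\<alpha> ?g x = ?g e)"
      using reg regular_extension_open_cell[OF \<alpha> _ n] by blast
  next
    fix f
    assume "regular_step_function n j ?\<alpha> f \<and> (\<forall>e\<in>open_grid n j. \<forall>x\<in>cell n ?\<alpha> e. f x = ?g e)"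
    \<comment> \<open>Centers lie in their open cells, so the condition on cells fixes the values at
      centers.\<close>
    then show "f = regular_extension n j ?\<alpha> ?g"
      using center_in_cell[OF \<alpha>] by (intro regular_step_function_eq_regular_extension) blast+
  qed
qed

text \<open>Each coordinate of \<open>z\<close> lies in exactly one closed interval, the one with
  index \<open>y h\<close>, so the average has a single term. At the two corners, which are not
  averaged, the values agree because \<open>v\<close> is 0 and \<open>k - 1\<close> there.\<close>

lemma natural_embedding_eq:
  assumes j: "j \<ge> 2" and n: "n \<ge> 1" and k: "k \<ge> 2" and v: "jk_simple_game n j k v"
    and y: "y \<in> {1..n} \<rightarrow>\<^sub>E {0..<j}" and z: "z \<in> cube n"
    and coords: "\<And>h. h \<in> {1..n} \<Longrightarrow> z h \<in> {real (y h) / real j <..< real (Suc (y h)) / real j} \<or>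
       z h = 0 \<and> y h = 0 \<or> z h = 1 \<and> y h = j - 1"
  shows "natural_embedding n j k v z = real (v y) / (real k - 1)"
proof -
  let ?\<alpha> = "\<lambda>m. real m / real j"
  let ?g = "\<lambda>e. real (v (\<lambda>h\<in>{1..n}. nat \<lfloor>e h - 1 / 2\<rfloor>)) / (real k - 1)"
  have \<alpha>: "discretization j ?\<alpha>"
    using j by (intro discretization_uniform) simp
  have yj: "y h < j" if "h \<in> {1..n}" for h
    using y that by (auto simp: PiE_iff)
  \<comment> \<open>Open grid intervals avoid 0 and 1, so at the two corners only the boundary
    alternatives of \<open>coords\<close> remain.\<close>
  have pos: "0 < t \<and> t < 1" if "t \<in> {?\<alpha> m <..< ?\<alpha> (Suc m)}" "m < j" for t m
    using discretization_bounds(1)[OF \<alpha>, of m] discretization_bounds(2)[OF \<alpha>, of "Suc m"] that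
    by (simp only: greaterThanLessThan_iff) linarith
  have v0: "v (const_vec n 0) = 0" "v (const_vec n (j - 1)) = k - 1"
    using v by (auto simp: jk_simple_game_def)
  have embedding: "natural_embedding n j k v = regular_extension n j ?\<alpha> ?g"
    using natural_embedding_eq_regular_extension[of j n k v] j n k v by (auto simp: jk_simple_game_def)
  consider "z = const_vec n 0" | "z = const_vec n 1" | "z \<noteq> const_vec n 0" "z \<noteq> const_vec n 1"
    by blast
  then show ?thesis
  proof cases
    case 1
    have "y h = 0" if h: "h \<in> {1..n}" for h
    proof -
      have "z h = 0" using 1 h by (simp add: const_vec_def)
      then show ?thesis using coords[OF h] pos[of "z h" "y h"] yj[OF h] by auto
    qed
    then have "y = const_vec n 0"
      by (intro PiE_ext[OF y]) (use j in \<open>auto simp: const_vec_def\<close>)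
    then show ?thesis
      unfolding embedding by (simp add: v0 1 regular_extension_def const_vec_in_cube)
  next
    case 2
    have "y h = j - 1" if h: "h \<in> {1..n}" for h
    proof -
      have "z h = 1" using 2 h by (simp add: const_vec_def)
      then show ?thesis using coords[OF h] pos[of "z h" "y h"] yj[OF h] by auto
    qed
    then have "y = const_vec n (j - 1)"
      by (intro PiE_ext[OF y]) (use j in \<open>auto simp: const_vec_def\<close>)
    moreover have "const_vec n (1::real) \<noteq> const_vec n 0"
      using n by (auto simp: const_vec_def fun_eq_iff intro!: exI[of _ 1])
    ultimately show ?thesis
      unfolding embedding using k v0(2)
      by (simp add: 2 regular_extension_def const_vec_in_cube of_nat_diff)
  next
    case 3
    \<comment> \<open>The shift by 1/2 inverts the passage from half-integer cell indices to
      arguments of \<open>v\<close>.\<close>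
    let ?e = "\<lambda>h\<in>{1..n}. real (y h) + 1 / 2"
    have e: "?e \<in> open_grid n j"
      using yj unfolding open_grid_def by auto
    have step: "?\<alpha> m < ?\<alpha> (Suc m)" for m
      using j by (simp add: divide_strict_right_mono)
    have zcl: "z h \<in> {?\<alpha> (y h) .. ?\<alpha> (Suc (y h))}" if h: "h \<in> {1..n}" for h
      using coords[OF h] step[of "y h"] j by (auto simp: field_simps)
    have "adjacent_cells n j ?\<alpha> z = {?e}"
    proof (rule adjacent_cells_eq_singleton[OF \<alpha> e])
      have "z h \<in> closure (side ?\<alpha> (?e h))" if h: "h \<in> {1..n}" for h
        using zcl[OF h] h closure_side_half[OF \<alpha> yj[OF h]] by (metis (no_types, lifting) restrict_apply')
      then show "z \<in> closed_cell n ?\<alpha> ?e"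
        using z unfolding closed_cell_def cube_def by (auto simp: PiE_iff)
      fix h m assume h: "h \<in> {1..n}" and m: "m < j" "z h \<in> {?\<alpha> m .. ?\<alpha> (Suc m)}"
      have "m = y h"
        using coords[OF h]
      proof (elim disjE conjE)
        assume "z h \<in> {?\<alpha> (y h) <..< ?\<alpha> (Suc (y h))}"
        then show ?thesis using interval_index_unique[OF \<alpha> yj[OF h] m(1) _ m(2)] by blast
      next
        assume "z h = 0" "y h = 0"
        then show ?thesis using m j by (simp add: divide_le_0_iff)
      next
        assume "z h = 1" "y h = j - 1"
        then show ?thesis using m j by (simp add: le_divide_eq)
      qed
      then show "?e h = real m + 1 / 2" using h by simp
    qed
    then have "natural_embedding n j k v z = ?g ?e"
      unfolding embedding using regular_extension_singleton[OF z 3] by blast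
    moreover have "(\<lambda>h\<in>{1..n}. nat \<lfloor>?e h - 1 / 2\<rfloor>) = y"
      by (rule PiE_ext[OF _ y]) (use yj in auto)
    ultimately show ?thesis by simp
  qed
qed

section \<open>Integrating functions that are constant on a grid of boxes\<close>

text \<open>For \<open>y\<close> in J^n this is the full-dimensional cell of the uniform
  discretization with index \<open>y\<close> plus 1/2; indexed by \<open>y\<close>, it can be
  matched directly with an argument of \<open>v\<close>.\<close>

definition grid_box :: "nat \<Rightarrow> nat \<Rightarrow> (nat \<Rightarrow> nat) \<Rightarrow> (nat \<Rightarrow> real) set" where
  "grid_box n j y = (\<Pi>\<^sub>E h\<in>{1..n}. {real (y h) / real j <..< real (Suc (y h)) / real j})"

section \<open>Null sets and the completed product measure\<close>

text \<open>Preimages under \<open>f\<close> and \<open>g\<close> differ by a null set only. This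
  makes an integrand measurable that is known only off the grid hyperplanes.\<close>

lemma borel_measurable_completion_AE:
  fixes g :: "'a \<Rightarrow> 'b::topological_space"
  assumes f: "f \<in> borel_measurable M" and ae: "AE x in M. f x = g x"
  shows "g \<in> borel_measurable (completion M)"
proof (rule measurableI)
  fix A :: "'b set" assume A: "A \<in> sets borel"
  show "g -` A \<inter> space (completion M) \<in> sets (completion M)"
  proof (rule completion.in_sets_AE)
    show "f -` A \<inter> space M \<in> sets (completion M)"
      using measurable_sets[OF f A] by auto
    show "AE x in completion M. x \<in> f -` A \<inter> space M \<longleftrightarrow> x \<in> g -` A \<inter> space (completion M)"
      using AE_completion[OF ae] by eventually_elim auto
  qed simp
qed simp

lemma AE_PiM_lborel_coordinate_neq:
  assumes I: "finite I" and h: "h \<in> I"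
  shows "AE x in PiM I (\<lambda>_. lborel). x h \<noteq> (c::real)"
proof -
  interpret product_sigma_finite "\<lambda>_. lborel :: real measure" by standard
  let ?N = "\<Pi>\<^sub>E i\<in>I. if i = h then {c} else (UNIV :: real set)"
  have "emeasure (PiM I (\<lambda>_. lborel)) ?N = (\<Prod>i\<in>I. emeasure lborel (if i = h then {c} else (UNIV :: real set)))"
    using I by (intro emeasure_PiM) auto
  \<comment> \<open>The factor at \<open>h\<close> is 0 and all others are infinite; in
    \<open>ennreal\<close> such a product is 0.\<close>
  also have "\<dots> = 0"
    using I h by (intro prod_zero) auto
  moreover have "?N \<in> sets (PiM I (\<lambda>_. lborel))"
    using I by (intro sets_PiM_I_finite) auto
  ultimately have "?N \<in> null_sets (PiM I (\<lambda>_. lborel))"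
    by auto
  then show ?thesis
    by (rule AE_I') (auto simp: space_PiM PiE_iff extensional_def)
qed

lemma grid_box_sets: "grid_box n j y \<in> sets (PiM {1..n} (\<lambda>_. lborel))"
  unfolding grid_box_def by (intro sets_PiM_I_finite) auto

lemma emeasure_grid_box:
  assumes "j \<ge> 1"
  shows "emeasure (PiM {1..n} (\<lambda>_. lborel)) (grid_box n j y) = ennreal ((1 / real j) ^ n)"
proof -
  interpret product_sigma_finite "\<lambda>_. lborel :: real measure" by standard
  have "emeasure lborel {real m / real j <..< real (Suc m) / real j} = ennreal (1 / real j)" for m
    using assms by (subst emeasure_lborel_Ioo) (auto simp: field_simps divide_right_mono)
  then show ?thesis
    unfolding grid_box_def by (subst emeasure_PiM) (auto simp: ennreal_power)
qed

text \<open>Scaling by \<open>j\<close> turns each side into the open interval between consecutive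
  integers. A point thus determines the index of its box, which makes boxes with different indices
  in J^n disjoint.\<close>

lemma grid_box_index:
  assumes "j \<ge> 1" and x: "x \<in> grid_box n j y" and h: "h \<in> {1..n}"
  shows "nat \<lfloor>real j * x h\<rfloor> = y h"
proof -
  have "real (y h) / real j < x h" "x h < real (Suc (y h)) / real j"
    using x h unfolding grid_box_def by (auto simp: PiE_iff)
  then have "\<lfloor>real j * x h\<rfloor> = int (y h)"
    using assms(1) by (intro floor_unique) (auto simp: field_simps)
  then show ?thesis by simp
qed

lemma grid_box_subset_cube:
  assumes "j \<ge> 1" and y: "y \<in> {1..n} \<rightarrow>\<^sub>E {0..<j}"
  shows "grid_box n j y \<subseteq> cube n"
  unfolding grid_box_def cube_def
proof (rule PiE_mono)
  fix h assume "h \<in> {1..n}"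
  then have "Suc (y h) \<le> j"
    using y by (auto simp: PiE_iff Suc_le_eq)
  then have "real (Suc (y h)) / real j \<le> 1"
    using assms(1) by (simp add: divide_le_eq_1 del: of_nat_Suc)
  moreover have "0 \<le> real (y h) / real j" by simp
  ultimately show "{real (y h) / real j <..< real (Suc (y h)) / real j} \<subseteq> {0..1}"
    by (intro subsetI) (simp only: greaterThanLessThan_iff atLeastAtMost_iff, linarith)
qed

text \<open>The index is \<open>real j * x h\<close> rounded down. Avoiding the grid value with
  \<open>m = j\<close> excludes \<open>x h = 1\<close>, which would give the index \<open>j\<close>;
  avoiding the others makes the lower bounds strict.\<close>

lemma cube_grid_boxE:
  assumes j: "j \<ge> 1" and x: "x \<in> cube n" and off_grid: "\<forall>h\<in>{1..n}. \<forall>m\<in>{..j}. x h \<noteq> real m / real j"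
  obtains y where "y \<in> {1..n} \<rightarrow>\<^sub>E {0..<j}" "x \<in> grid_box n j y"
proof
  let ?y = "\<lambda>h\<in>{1..n}. nat \<lfloor>real j * x h\<rfloor>"
  have y: "?y h < j \<and> real (?y h) / real j < x h \<and> x h < real (Suc (?y h)) / real j" if h: "h \<in> {1..n}" for h
  proof -
    have x01: "0 \<le> x h" "x h \<le> 1"
      using x h unfolding cube_def by (auto simp: PiE_iff)
    moreover have "x h \<noteq> 1"
      using off_grid[rule_format, OF h, of j] j by simp
    ultimately have lt: "real j * x h < real j"
      using j by simp
    have "real (?y h) = real_of_int \<lfloor>real j * x h\<rfloor>"
      using h x01 by simp
    then have fl: "real (?y h) \<le> real j * x h" "real j * x h < real (?y h) + 1"
      by linarith+
    then have less: "?y h < j"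
      using lt by linarith
    moreover have "x h \<noteq> real (?y h) / real j"
      using off_grid h less by (meson atMost_iff less_imp_le)
    then have "real (?y h) \<noteq> real j * x h"
      using j by (auto simp: field_simps)
    ultimately show ?thesis
      using fl j by (auto simp: field_simps)
  qed
  then show "?y \<in> {1..n} \<rightarrow>\<^sub>E {0..<j}"
    by (auto simp del: of_nat_nat)
  show "x \<in> grid_box n j ?y"
    using y x unfolding grid_box_def cube_def by (auto simp: PiE_iff simp del: restrict_apply of_nat_Suc)
qed

text \<open>Almost everywhere the integrand on the cube equals the simple function
  \<open>?T\<close>, since finitely many grid hyperplanes form a null set; each box contributes its
  value times its volume. Measurability of the integrand is derived from that of
  \<open>?T\<close>.\<close>

lemma integral_cube_grid_boxes:
  fixes d :: "(nat \<Rightarrow> nat) \<Rightarrow> real"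
  assumes j: "j \<ge> 1"
    and f: "\<And>x y. y \<in> {1..n} \<rightarrow>\<^sub>E {0..<j} \<Longrightarrow> x \<in> grid_box n j y \<Longrightarrow> f x = d y"
  shows "(LINT x:cube n|completion (PiM {1..n} (\<lambda>_. lborel)). f x) =
    (\<Sum>y\<in>{1..n} \<rightarrow>\<^sub>E {0..<j}. d y) / real j ^ n"
proof -
  let ?M = "PiM {1..n} (\<lambda>_. lborel :: real measure)"
  let ?J = "{1..n} \<rightarrow>\<^sub>E {0..<j}"
  let ?T = "\<lambda>x. \<Sum>y\<in>?J. indicator (grid_box n j y) x *\<^sub>R d y"
  have finite: "finite ?J" by (intro finite_PiE) auto
  have T: "?T \<in> borel_measurable ?M"
    using grid_box_sets by (intro borel_measurable_sum borel_measurable_scaleR borel_measurable_indicator) auto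
  have T_eq: "?T x = d y" if y: "y \<in> ?J" "x \<in> grid_box n j y" for x y
  proof -
    \<comment> \<open>Equal box indices on all players would give \<open>z = y\<close> by
      extensionality.\<close>
    have "x \<notin> grid_box n j z" if z: "z \<in> ?J" "z \<noteq> y" for z
      using PiE_ext[OF z(1) y(1)] z(2) grid_box_index[OF j] y(2) by metis
    then have "?T x = (\<Sum>z\<in>?J. if z = y then d y else 0)"
      using y by (intro sum.cong) (auto simp: indicator_def)
    then show ?thesis using y finite by simp
  qed
  have "AE x in ?M. \<forall>h\<in>{1..n}. \<forall>m\<in>{..j}. x h \<noteq> real m / real j"
    by (intro AE_finite_allI AE_PiM_lborel_coordinate_neq) auto
  then have ae: "AE x in ?M. ?T x = indicator (cube n) x *\<^sub>R f x"
  proof eventually_elim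
    case (elim x)
    show ?case
    proof (cases "x \<in> cube n")
      case True
      then obtain y where "y \<in> ?J" "x \<in> grid_box n j y"
        using cube_grid_boxE[OF j] elim by blast
      then show ?thesis using True T_eq f by simp
    next
      case False
      then have "x \<notin> grid_box n j y" if "y \<in> ?J" for y
        using grid_box_subset_cube[OF j that] by blast
      then show ?thesis using False by simp
    qed
  qed
  have fin: "emeasure ?M (grid_box n j y) < \<infinity>" for y
    using emeasure_grid_box[OF j] by simp
  have meas: "measure ?M (grid_box n j y) = (1 / real j) ^ n" for y
    using emeasure_grid_box[OF j] by (simp add: measure_def)
  have "(LINT x:cube n|completion ?M. f x) = (LINT x|completion ?M. ?T x)"
    unfolding set_lebesgue_integral_def
  proof (rule integral_cong_AE)
    show "(\<lambda>x. indicator (cube n) x *\<^sub>R f x) \<in> borel_measurable (completion ?M)"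
      by (rule borel_measurable_completion_AE[OF T ae])
    show "AE x in completion ?M. indicator (cube n) x *\<^sub>R f x = ?T x"
      using AE_completion[OF ae] by eventually_elim simp
  qed (rule measurable_completion[OF T])
  \<comment> \<open>\<open>?T\<close> is already measurable for the uncompleted product, where box
    volumes are products of side lengths.\<close>
  also have "\<dots> = (LINT x|?M. ?T x)"
    by (rule integral_completion[OF T])
  also have "\<dots> = (\<Sum>y\<in>?J. LINT x|?M. indicator (grid_box n j y) x *\<^sub>R d y)"
    using grid_box_sets fin by (intro Bochner_Integration.integral_sum integrable_indicator) auto
  also have "\<dots> = (\<Sum>y\<in>?J. (1 / real j) ^ n * d y)"
    using grid_box_sets fin meas by (intro sum.cong refl) (subst has_bochner_integral_integral_eq[OF has_bochner_integral_indicator], auto)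
  also have "\<dots> = (\<Sum>y\<in>?J. d y) / real j ^ n"
    by (simp add: sum_divide_distrib power_divide)
  finally show ?thesis .
qed

section \<open>The two indices\<close>

text \<open>Coordinates in \<open>S\<close> stay interior to their intervals, and the others become
  0 or 1. The greatest entry 1 is paired with \<open>j - 1\<close>, the index of the last
  interval.\<close>

lemma natural_embedding_glue:
  assumes j: "j \<ge> 2" and n: "n \<ge> 1" and k: "k \<ge> 2" and v: "jk_simple_game n j k v"
    and y: "y \<in> {1..n} \<rightarrow>\<^sub>E {0..<j}" and x: "x \<in> grid_box n j y"
    and c: "c = 0 \<and> d = 0 \<or> c = 1 \<and> d = j - 1"
  shows "natural_embedding n j k v (glue n S x (const_vec n c)) =
    real (v (glue n S y (const_vec n d))) / (real k - 1)"
proof (rule natural_embedding_eq[OF j n k v])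
  have "x \<in> cube n"
    using grid_box_subset_cube[OF _ y] j x by auto
  then show "glue n S x (const_vec n c) \<in> cube n"
    using c by (auto simp: glue_def cube_def const_vec_def PiE_iff)
  show "glue n S y (const_vec n d) \<in> {1..n} \<rightarrow>\<^sub>E {0..<j}"
    using y c j by (auto simp: glue_def const_vec_def PiE_iff)
  fix h assume h: "h \<in> {1..n}"
  then have "x h \<in> {real (y h) / real j <..< real (Suc (y h)) / real j}"
    using PiE_mem[OF x[unfolded grid_box_def]] by blast
  then show "glue n S x (const_vec n c) h \<in> {real (glue n S y (const_vec n d) h) / real j <..<
        real (Suc (glue n S y (const_vec n d) h)) / real j} \<or>
      glue n S x (const_vec n c) h = 0 \<and> glue n S y (const_vec n d) h = 0 \<or>
      glue n S x (const_vec n c) h = 1 \<and> glue n S y (const_vec n d) h = j - 1"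
    using h c by (auto simp: glue_def const_vec_def)
qed

lemma influence_drop_natural_embedding:
  assumes "j \<ge> 2" "n \<ge> 1" "k \<ge> 2" "jk_simple_game n j k v"
    and "y \<in> {1..n} \<rightarrow>\<^sub>E {0..<j}" "x \<in> grid_box n j y"
  shows "influence_drop n 0 1 (natural_embedding n j k v) i \<pi> x =
    influence_drop n 0 (j - 1) (\<lambda>y. real (v y)) i \<pi> y / (real k - 1)"
proof -
  have "natural_embedding n j k v (glue n S x (const_vec n 0)) =
      real (v (glue n S y (const_vec n 0))) / (real k - 1)"
    and "natural_embedding n j k v (glue n S x (const_vec n 1)) =
      real (v (glue n S y (const_vec n (j - 1)))) / (real k - 1)" for S
    by (rule natural_embedding_glue[OF assms]; simp)+
  then show ?thesis
    by (simp only: influence_drop_def diff_divide_distrib)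
qed

theorem proposition7:
  fixes n j k :: nat and v :: "(nat \<Rightarrow> nat) \<Rightarrow> nat"
  assumes "j \<ge> 2" and "k \<ge> 2"
    and "jk_simple_game n j k v"
  shows "SSI n j k v = Psi n (natural_embedding n j k v)"
proof -
  let ?P = "{\<pi>. \<pi> permutes {1..n}}"
  let ?J = "{1..n} \<rightarrow>\<^sub>E {0..<j}"
  have "1 / (fact n * real j ^ n * (real k - 1)) *
      (\<Sum>(\<pi>, x)\<in>?P \<times> ?J. influence_drop n 0 (j - 1) (\<lambda>y. real (v y)) i \<pi> x) =
    1 / fact n * (\<Sum>\<pi>\<in>?P. LINT x:cube n|completion (PiM {1..n} (\<lambda>_. lborel)).
      influence_drop n 0 1 (natural_embedding n j k v) i \<pi> x)" (is "?lhs = ?rhs")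
    if i: "i \<in> {1..n}" for i
  proof -
    \<comment> \<open>The facts on the embedding require a player, and \<open>i\<close> is one.
      Without players both indices are restrictions to the empty set.\<close>
    have n: "n \<ge> 1" using i by simp
    have "(LINT x:cube n|completion (PiM {1..n} (\<lambda>_. lborel)).
        influence_drop n 0 1 (natural_embedding n j k v) i \<pi> x) =
      (\<Sum>y\<in>?J. influence_drop n 0 (j - 1) (\<lambda>y. real (v y)) i \<pi> y / (real k - 1)) / real j ^ n" for \<pi>
      using assms n influence_drop_natural_embedding by (intro integral_cube_grid_boxes) auto
    then have "?rhs = 1 / fact n * (\<Sum>\<pi>\<in>?P.
        (\<Sum>y\<in>?J. influence_drop n 0 (j - 1) (\<lambda>y. real (v y)) i \<pi> y) / (real k - 1) / real j ^ n)"
      by (simp only: sum_divide_distrib)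
    also have "\<dots> = ?lhs"
      by (simp add: sum.cartesian_product[symmetric] sum_divide_distrib[symmetric] mult_ac)
    finally show ?thesis by simp
  qed
  then show ?thesis
    unfolding SSI_def Psi_def by (intro restrict_ext) blast
qed

end
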